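(* Let $\mathcal{M}$ be a fully-transitive 3-maniplex and let $T(\mathcal{M})$ be its symmetry type graph. Then either $\mathcal{M}$ is reflexible or $T(\mathcal{M})$ has an even number of vertices (i.e. $\mathrm{Aut}(\mathcal{M})$ has an even number of orbits on flags).
   Context: A 3-maniplex is given by a connected simple graph (flag graph), whose vertices are called flags, with a proper edge-colouring by colours $\{0,1,2,3\}$, each colour class a perfect matching, such that for colours $i,j$ with $|i-j|\ge2$ each component of the subgraph spanned by colours $i,j$ is a 4-cycle. Automorphisms are colour-preserving graph automorphisms; $\mathcal{M}$ is reflexible if $\mathrm{Aut}(\mathcal{M})$ is transitive on flags. An $i$-face is a connected component of the flag graph with the $i$-edges removed; $\mathcal{M}$ is fully-transitive if $\mathrm{Aut}(\mathcal{M})$ is transitive on $i$-faces for each $i\in\{0,1,2,3\}$. The symmetry type graph $T(\mathcal{M})$ is the pregraph whose vertices are the $\mathrm{Aut}(\mathcal{M})$-orbits of flags, with an edge of colour $a$ between distinct orbits $B,C$ iff some flag of $B$ is $a$-adjacent to a flag of $C$, and a semi-edge of colour $a$ at $B$ iff some flag of $B$ is $a$-adjacent to a flag of $B$. *)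

theory Defs
  imports "HOL-Algebra.Group_Action"
begin

record 'f coloured_graph =
  flags :: "'f set"
  edges :: "'f set set"
  colour :: "'f set \<Rightarrow> nat"

definition simple_graph :: "('f, 'm) coloured_graph_scheme \<Rightarrow> bool" where
  "simple_graph M \<longleftrightarrow> (\<forall>e\<in>edges M. e \<subseteq> flags M \<and> card e = 2)"

definition proper_colouring :: "('f, 'm) coloured_graph_scheme \<Rightarrow> bool" where
  "proper_colouring M \<longleftrightarrow>
     (\<forall>e\<in>edges M. \<forall>e'\<in>edges M. e \<noteq> e' \<and> e \<inter> e' \<noteq> {} \<longrightarrow> colour M e \<noteq> colour M e')"

definition colour_class :: "('f, 'm) coloured_graph_scheme \<Rightarrow> nat \<Rightarrow> 'f set set" where
  "colour_class M i = {e \<in> edges M. colour M e = i}"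

definition perfect_matching :: "'f set \<Rightarrow> 'f set set \<Rightarrow> bool" where
  "perfect_matching V S \<longleftrightarrow> (\<forall>e\<in>S. e \<subseteq> V) \<and> (\<forall>v\<in>V. \<exists>!e. e \<in> S \<and> v \<in> e)"

definition adjacent :: "('f, 'm) coloured_graph_scheme \<Rightarrow> nat \<Rightarrow> 'f \<Rightarrow> 'f \<Rightarrow> bool" where
  "adjacent M i x y \<longleftrightarrow> {x, y} \<in> colour_class M i"

text \<open>Connected components of the spanning subgraph whose edges are those with colour in \<open>C\<close>.
  A component is represented by its vertex set.\<close>

definition component :: "('f, 'm) coloured_graph_scheme \<Rightarrow> nat set \<Rightarrow> 'f \<Rightarrow> 'f set" where
  "component M C x = {y. (x, y) \<in> {(u, v). \<exists>i\<in>C. adjacent M i u v}\<^sup>*}"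

definition components :: "('f, 'm) coloured_graph_scheme \<Rightarrow> nat set \<Rightarrow> 'f set set" where
  "components M C = component M C ` flags M"

definition connected_graph :: "('f, 'm) coloured_graph_scheme \<Rightarrow> bool" where
  "connected_graph M \<longleftrightarrow> flags M \<noteq> {} \<and> (\<forall>x\<in>flags M. component M UNIV x = flags M)"

definition four_cycle :: "'f set \<Rightarrow> 'f set set \<Rightarrow> bool" where
  "four_cycle V S \<longleftrightarrow>
     (\<exists>a b c d. distinct [a, b, c, d] \<and> V = {a, b, c, d} \<and> S = {{a, b}, {b, c}, {c, d}, {d, a}})"

locale maniplex3 =
  fixes M :: "('f, 'm) coloured_graph_scheme" (structure)
  assumes simple: "simple_graph M"
    and connected: "connected_graph M"
    and colours: "\<forall>e\<in>edges M. colour M e \<in> {0, 1, 2, 3}"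
    and proper: "proper_colouring M"
    and matching: "\<forall>i\<in>{0, 1, 2, 3}. perfect_matching (flags M) (colour_class M i)"
    and cycles: "\<forall>i\<in>{0, 1, 2, 3}. \<forall>j\<in>{0, 1, 2, 3}. \<bar>int i - int j\<bar> \<ge> 2 \<longrightarrow>
      (\<forall>K\<in>components M {i, j}.
         four_cycle K {e \<in> colour_class M i \<union> colour_class M j. e \<subseteq> K})"

text \<open>As for \<^const>\<open>AutoGroup\<close>, automorphisms are taken to be extensional, i.e. \<^const>\<open>undefined\<close>
  outside the set of flags, so that distinct elements of the group differ on some flag.\<close>

definition automorphisms :: "('f, 'm) coloured_graph_scheme \<Rightarrow> ('f \<Rightarrow> 'f) set" where
  "automorphisms M = {g \<in> Bij (flags M).
     (\<forall>x\<in>flags M. \<forall>y\<in>flags M. {g x, g y} \<in> edges M \<longleftrightarrow> {x, y} \<in> edges M) \<and>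
     (\<forall>e\<in>edges M. colour M (g ` e) = colour M e)}"

definition Aut :: "('f, 'm) coloured_graph_scheme \<Rightarrow> ('f \<Rightarrow> 'f) monoid" where
  "Aut M = BijGroup (flags M) \<lparr>carrier := automorphisms M\<rparr>"

definition flag_orbits :: "('f, 'm) coloured_graph_scheme \<Rightarrow> 'f set set" where
  "flag_orbits M = orbits (Aut M) (flags M) (\<lambda>g. g)"

definition reflexible :: "('f, 'm) coloured_graph_scheme \<Rightarrow> bool" where
  "reflexible M \<longleftrightarrow> (\<forall>x\<in>flags M. \<forall>y\<in>flags M. \<exists>g\<in>carrier (Aut M). g x = y)"

definition faces :: "('f, 'm) coloured_graph_scheme \<Rightarrow> nat \<Rightarrow> 'f set set" where
  "faces M i = components M (- {i})"

definition fully_transitive :: "('f, 'm) coloured_graph_scheme \<Rightarrow> bool" where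
  "fully_transitive M \<longleftrightarrow>
     (\<forall>i\<in>{0, 1, 2, 3}. \<forall>X\<in>faces M i. \<forall>Y\<in>faces M i. \<exists>g\<in>carrier (Aut M). g ` X = Y)"

text \<open>A coloured edge is a pair of a colour and its set of two ends, a coloured semi-edge is a pair
  of a colour and its only end.\<close>

record 'v pregraph =
  vertices :: "'v set"
  links :: "(nat \<times> 'v set) set"
  semi_edges :: "(nat \<times> 'v) set"

definition symmetry_type_graph :: "('f, 'm) coloured_graph_scheme \<Rightarrow> 'f set pregraph" where
  "symmetry_type_graph M = \<lparr>
     vertices = flag_orbits M,
     links = {(a, {B, C}) | a B C. a \<in> {0, 1, 2, 3} \<and> B \<in> flag_orbits M \<and> C \<in> flag_orbits M \<and>
       B \<noteq> C \<and> (\<exists>x\<in>B. \<exists>y\<in>C. adjacent M a x y)},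
     semi_edges = {(a, B) | a B. a \<in> {0, 1, 2, 3} \<and> B \<in> flag_orbits M \<and>
       (\<exists>x\<in>B. \<exists>y\<in>B. adjacent M a x y)}\<rparr>"

end

theory Submission
  imports Defs
begin

text \<open>
  Every colour \<open>i\<close> acts on the set of flag orbits as an involution \<open>s\<^sub>i\<close>, and \<open>s\<^sub>i\<close>, \<open>s\<^sub>j\<close> commute
  for \<open>\<bar>i - j\<bar> \<ge> 2\<close>. Transitivity on \<open>i\<close>-faces says that the \<open>s\<^sub>j\<close> with \<open>j \<noteq> i\<close> act transitively.
  If the number of orbits is odd, then \<open>s\<^sub>0\<close> fixes an orbit. As \<open>s\<^sub>0\<close> is central in the transitive
  group \<open>\<langle>s\<^sub>0, s\<^sub>2, s\<^sub>3\<rangle>\<close>, it is then the identity; likewise \<open>s\<^sub>3\<close> is central in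
  \<open>\<langle>s\<^sub>0, s\<^sub>1, s\<^sub>3\<rangle>\<close>, hence the identity. So \<open>s\<^sub>2\<close> alone acts transitively, which
  leaves at most two orbits, and therefore exactly one.
\<close>

section \<open>Involutions on a finite set\<close>

lemma even_card_involution:
  assumes "finite A"
    and "\<And>x. x \<in> A \<Longrightarrow> s x \<in> A"
    and "\<And>x. x \<in> A \<Longrightarrow> s (s x) = x"
    and "\<And>x. x \<in> A \<Longrightarrow> s x \<noteq> x"
  shows "even (card A)"
  using assms
proof (induction A rule: finite_psubset_induct)
  case (psubset A)
  show ?case
  proof (cases "A = {}")
    case False
    then obtain x where x: "x \<in> A" by blast
    \<comment> \<open>The involution partitions \<open>A\<close> into pairs \<open>{x, s x}\<close>;
      the induction removes one pair, and what is left is still closed under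
      \<open>s\<close>.\<close>
    define B where "B = A - {x, s x}"
    have "even (card B)"
    proof (rule psubset.IH)
      show "B \<subset> A" using x by (auto simp: B_def)
      show "s y \<in> B" if "y \<in> B" for y
        using that psubset.prems x unfolding B_def by (metis Diff_iff insert_iff singletonD)
      show "s (s y) = y" "s y \<noteq> y" if "y \<in> B" for y
        using that psubset.prems by (auto simp: B_def)
    qed
    moreover have "card A = card B + card {x, s x}"
      unfolding B_def using psubset x
      by (metis card_Diff_subset card_mono empty_subsetI finite.emptyI finite.insertI insert_subset
          le_add_diff_inverse2)
    moreover have "card {x, s x} = 2" using psubset.prems x by (metis card_2_iff)
    ultimately show ?thesis by simp
  qed simp
qed

text \<open>By parity \<open>s\<close> has a fixed point, and since \<open>s\<close> commutes with
  every map in \<open>T\<close>, its fixed points form a set closed under \<open>T\<close>.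
  Transitivity is phrased as \<open>V\<close> having no proper nonempty closed subset, so the group
  generated by \<open>T\<close> need not be formed.\<close>

lemma commuting_involution_trivial:
  assumes "finite V" and "odd (card V)"
    and s: "\<And>B. B \<in> V \<Longrightarrow> s B \<in> V" "\<And>B. B \<in> V \<Longrightarrow> s (s B) = B"
    and trans: "\<And>W. \<lbrakk>W \<subseteq> V; W \<noteq> {}; \<And>t B. t \<in> T \<Longrightarrow> B \<in> W \<Longrightarrow> t B \<in> W\<rbrakk> \<Longrightarrow> W = V"
    and T: "\<And>t B. t \<in> T \<Longrightarrow> B \<in> V \<Longrightarrow> t B \<in> V"
    and comm: "\<And>t B. t \<in> T \<Longrightarrow> B \<in> V \<Longrightarrow> s (t B) = t (s B)"
    and "B \<in> V"
  shows "s B = B"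
proof -
  have "{B \<in> V. s B = B} \<noteq> {}"
    using even_card_involution[of V s] assms(1,2) s by auto
  then have "{B \<in> V. s B = B} = V"
    by (intro trans) (auto simp: T comm)
  with \<open>B \<in> V\<close> show ?thesis by blast
qed

text \<open>The combinatorial core, free of maniplexes: \<open>V\<close> stands for the set of flag
  orbits, \<open>s i\<close> for the action of colour \<open>i\<close> on it, and
  \<open>trans\<close> for transitivity on \<open>i\<close>-faces.\<close>

lemma one_of_odd_transitive_involutions:
  fixes s :: "nat \<Rightarrow> 'a \<Rightarrow> 'a"
  assumes fin: "finite V" and odd: "odd (card V)"
    and s: "\<And>i B. i \<in> {0, 1, 2, 3} \<Longrightarrow> B \<in> V \<Longrightarrow> s i B \<in> V"
    and inv: "\<And>i B. i \<in> {0, 1, 2, 3} \<Longrightarrow> B \<in> V \<Longrightarrow> s i (s i B) = B"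
    and comm: "\<And>i j B. \<lbrakk>i \<in> {0, 1, 2, 3}; j \<in> {0, 1, 2, 3}; \<bar>int i - int j\<bar> \<ge> 2; B \<in> V\<rbrakk>
      \<Longrightarrow> s i (s j B) = s j (s i B)"
    and trans: "\<And>i W. \<lbrakk>i \<in> {0, 1, 2, 3}; W \<subseteq> V; W \<noteq> {};
        \<And>j B. j \<in> {0, 1, 2, 3} - {i} \<Longrightarrow> B \<in> W \<Longrightarrow> s j B \<in> W\<rbrakk> \<Longrightarrow> W = V"
  shows "card V = 1"
proof -
  \<comment> \<open>Colour 1 is left out because it is the only other colour at distance less than 2
    from 0; for \<open>s 3\<close> below, colour 2 is left out for the same reason.\<close>
  have s0: "s 0 B = B" if "B \<in> V" for B
    using fin odd
  proof (rule commuting_involution_trivial[where T = "s ` {0, 2, 3}"])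
    show "W = V" if W: "W \<subseteq> V" "W \<noteq> {}"
      and cl: "\<And>t B. t \<in> s ` {0, 2, 3} \<Longrightarrow> B \<in> W \<Longrightarrow> t B \<in> W" for W
      using W by (rule trans[of 1, rotated]) (auto intro: cl)
    show "t C \<in> V" if "t \<in> s ` {0, 2, 3}" "C \<in> V" for t C
      using that s by blast
    show "s 0 (t C) = t (s 0 C)" if "t \<in> s ` {0, 2, 3}" "C \<in> V" for t C
    proof -
      obtain j where "t = s j" "j \<in> {0, 2, 3}" using \<open>t \<in> _\<close> by blast
      then show ?thesis using comm[of 0 j C] \<open>C \<in> V\<close> by (cases "j = 0") auto
    qed
  qed (use s inv that in simp_all)
  have s3: "s 3 B = B" if "B \<in> V" for B
    using fin odd
  proof (rule commuting_involution_trivial[where T = "s ` {0, 1, 3}"])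
    show "W = V" if W: "W \<subseteq> V" "W \<noteq> {}"
      and cl: "\<And>t B. t \<in> s ` {0, 1, 3} \<Longrightarrow> B \<in> W \<Longrightarrow> t B \<in> W" for W
      using W by (rule trans[of 2, rotated]) (auto intro: cl)
    show "t C \<in> V" if "t \<in> s ` {0, 1, 3}" "C \<in> V" for t C
      using that s by blast
    show "s 3 (t C) = t (s 3 C)" if "t \<in> s ` {0, 1, 3}" "C \<in> V" for t C
    proof -
      obtain j where "t = s j" "j \<in> {0, 1, 3}" using \<open>t \<in> _\<close> by blast
      then show ?thesis using comm[of 3 j C] \<open>C \<in> V\<close> by (cases "j = 3") auto
    qed
  qed (use s inv that in simp_all)
  obtain B where B: "B \<in> V" using odd by fastforce
  \<comment> \<open>Without colour 1, only \<open>s 2\<close> can still move an orbit, so this pair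
    is closed; oddness then rules out two distinct elements.\<close>
  have "{B, s 2 B} = V"
    by (rule trans[of 1]) (use B in \<open>auto simp: s s0 s3 inv\<close>)
  then show ?thesis using odd by (cases "s 2 B = B") auto
qed

section \<open>Flags and their neighbours of each colour\<close>

context maniplex3
begin

lemma adjacent_sym: "adjacent M i x y \<longleftrightarrow> adjacent M i y x"
  by (simp add: adjacent_def insert_commute)

lemma adjacentD:
  assumes "adjacent M i x y"
  shows "x \<in> flags M" "y \<in> flags M" "x \<noteq> y" "i \<in> {0, 1, 2, 3}"
proof -
  have e: "{x, y} \<in> edges M" "colour M {x, y} = i"
    using assms by (auto simp: adjacent_def colour_class_def)
  then have "{x, y} \<subseteq> flags M" "card {x, y} = 2" using simple by (auto simp: simple_graph_def)
  then show "x \<in> flags M" "y \<in> flags M" "x \<noteq> y" by auto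
  show "i \<in> {0, 1, 2, 3}" using bspec[OF colours e(1)] e(2) by simp
qed

lemma ex1_adjacent:
  assumes "i \<in> {0, 1, 2, 3}" "x \<in> flags M"
  shows "\<exists>!y. adjacent M i x y"
proof -
  have "\<exists>!e. e \<in> colour_class M i \<and> x \<in> e"
    using bspec[OF matching assms(1)] assms(2) unfolding perfect_matching_def by blast
  then obtain e where e: "e \<in> colour_class M i" "x \<in> e"
    and uniq: "\<And>e'. e' \<in> colour_class M i \<Longrightarrow> x \<in> e' \<Longrightarrow> e' = e"
    by blast
  have "card e = 2" using simple e(1) by (auto simp: simple_graph_def colour_class_def)
  then obtain y where y: "e = {x, y}"
    using e(2) by (auto simp: card_2_iff)
  show ?thesis
  proof
    show "adjacent M i x y" using e y by (simp add: adjacent_def)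
    show "z = y" if "adjacent M i x z" for z
    proof -
      have "{x, z} = {x, y}" using that uniq y by (auto simp: adjacent_def)
      then show ?thesis by (auto simp: doubleton_eq_iff)
    qed
  qed
qed

text \<open>The generators of the monodromy group. The description denotes a neighbour only for a
  flag and a colour up to 3, hence these two premises in the lemmas that follow.\<close>

definition nbr :: "nat \<Rightarrow> 'f \<Rightarrow> 'f" where
  "nbr i x = (THE y. adjacent M i x y)"

lemma adjacent_nbr: "i \<in> {0, 1, 2, 3} \<Longrightarrow> x \<in> flags M \<Longrightarrow> adjacent M i x (nbr i x)"
  unfolding nbr_def by (rule theI'[OF ex1_adjacent])

lemma nbr_eqI:
  assumes "adjacent M i x y"
  shows "nbr i x = y"
  unfolding nbr_def using ex1_adjacent[OF adjacentD(4,1)[OF assms]] assms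
  by (rule the1_equality)

lemma nbr_in_flags: "i \<in> {0, 1, 2, 3} \<Longrightarrow> x \<in> flags M \<Longrightarrow> nbr i x \<in> flags M"
  by (rule adjacentD(2)[OF adjacent_nbr])

lemma nbr_nbr: "i \<in> {0, 1, 2, 3} \<Longrightarrow> x \<in> flags M \<Longrightarrow> nbr i (nbr i x) = x"
  by (intro nbr_eqI adjacent_nbr adjacent_sym[THEN iffD1])

lemma nbr_neq: "i \<in> {0, 1, 2, 3} \<Longrightarrow> x \<in> flags M \<Longrightarrow> nbr i x \<noteq> x"
  by (rule adjacentD(3)[OF adjacent_nbr, symmetric])

lemma nbr_neq_nbr:
  assumes "i \<in> {0, 1, 2, 3}" "j \<in> {0, 1, 2, 3}" "i \<noteq> j" "x \<in> flags M"
  shows "nbr i x \<noteq> nbr j x"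
  using adjacent_nbr[OF assms(1,4)] adjacent_nbr[OF assms(2,4)] assms(3)
  by (auto simp: adjacent_def colour_class_def)

text \<open>Otherwise the component of \<open>x\<close> in colours \<open>i\<close> and
  \<open>j\<close> would contain five different flags, whereas it is a 4-cycle.\<close>

lemma nbr_commute:
  assumes i: "i \<in> {0, 1, 2, 3}" and j: "j \<in> {0, 1, 2, 3}"
    and ij: "\<bar>int i - int j\<bar> \<ge> 2" and x: "x \<in> flags M"
  shows "nbr i (nbr j x) = nbr j (nbr i x)"
proof (rule ccontr)
  assume neq: "nbr i (nbr j x) \<noteq> nbr j (nbr i x)"
  have "i \<noteq> j" using ij by auto
  let ?K = "component M {i, j} x"
  have "?K \<in> components M {i, j}" using x by (simp add: components_def)
  then have "four_cycle ?K {e \<in> colour_class M i \<union> colour_class M j. e \<subseteq> ?K}"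
    using cycles i j ij by blast
  then have fin: "finite ?K" and card: "card ?K \<le> 4"
    by (auto simp: four_cycle_def card_insert_if)
  have step: "nbr k y \<in> ?K" if "y \<in> ?K" "y \<in> flags M" "k \<in> {i, j}" for y k
  proof -
    have "adjacent M k y (nbr k y)" using that i j adjacent_nbr by blast
    then show ?thesis using that unfolding component_def
      by (auto intro: rtrancl.rtrancl_into_rtrancl)
  qed
  have xK: "x \<in> ?K" by (simp add: component_def)
  let ?L = "[x, nbr i x, nbr j x, nbr i (nbr j x), nbr j (nbr i x)]"
  have L: "set ?L \<subseteq> ?K"
    using xK x i j nbr_in_flags step by simp
  \<comment> \<open>Cancelling an involution turns any coincidence other than the one excluded by
    \<open>neq\<close> into a flag being its own neighbour, or into two equal neighbours of
    different colours.\<close>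
  have "distinct ?L"
    using neq \<open>i \<noteq> j\<close> nbr_neq[OF i] nbr_neq[OF j] nbr_neq_nbr[OF i j] nbr_nbr[OF i] nbr_nbr[OF j]
      nbr_in_flags[OF i] nbr_in_flags[OF j] x
    by simp metis
  then have "5 = card (set ?L)" by (simp add: distinct_card)
  also have "\<dots> \<le> card ?K" using L fin by (rule card_mono[rotated])
  finally show False using card by simp
qed

section \<open>The automorphism group and its action on flags\<close>

text \<open>Preservation of edges and of colours merges into preservation of each relation
  \<open>adjacent M i\<close>, a form that passes directly to composites and inverses.\<close>

lemma automorphisms_iff:
  "g \<in> automorphisms M \<longleftrightarrow> g \<in> Bij (flags M) \<and>
     (\<forall>i. \<forall>x\<in>flags M. \<forall>y\<in>flags M. adjacent M i (g x) (g y) \<longleftrightarrow> adjacent M i x y)"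
  (is "_ \<longleftrightarrow> _ \<and> ?adj")
proof (intro iffI conjI)
  assume g: "g \<in> automorphisms M"
  then show "g \<in> Bij (flags M)" by (simp add: automorphisms_def)
  have col: "colour M {g x, g y} = colour M {x, y}" if "{x, y} \<in> edges M" for x y
    using g that by (force simp: automorphisms_def)
  show ?adj
    using g col by (auto simp: automorphisms_def adjacent_def colour_class_def)
next
  assume g: "g \<in> Bij (flags M) \<and> ?adj"
  then have adj: "{g x, g y} \<in> edges M \<and> colour M {g x, g y} = i \<longleftrightarrow>
      {x, y} \<in> edges M \<and> colour M {x, y} = i" if "x \<in> flags M" "y \<in> flags M" for x y i
    using that by (simp add: adjacent_def colour_class_def)
  have "colour M (g ` e) = colour M e" if e: "e \<in> edges M" for e
  proof -
    obtain x y where xy: "e = {x, y}" "x \<in> flags M" "y \<in> flags M"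
      using simple e by (auto simp: simple_graph_def card_2_iff)
    then show ?thesis using adj[of x y "colour M e"] e by simp
  qed
  then show "g \<in> automorphisms M" using g adj by (simp add: automorphisms_def) blast
qed

lemma subgroup_automorphisms: "subgroup (automorphisms M) (BijGroup (flags M))"
proof (rule group.subgroupI[OF group_BijGroup])
  show "automorphisms M \<subseteq> carrier (BijGroup (flags M))"
    by (auto simp: automorphisms_iff BijGroup_def)
  have "(\<lambda>x\<in>flags M. x) \<in> automorphisms M"
    by (simp add: automorphisms_iff id_Bij)
  then show "automorphisms M \<noteq> {}" by blast
next
  fix g assume g: "g \<in> automorphisms M"
  then have B: "g \<in> Bij (flags M)" by (simp add: automorphisms_iff)
  then have "g ` flags M = flags M" by (simp add: Bij_def bij_betw_def)
  then have "g (inv_into (flags M) g x) = x" "inv_into (flags M) g x \<in> flags M"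
    if "x \<in> flags M" for x
    using that by (auto simp: f_inv_into_f inv_into_into)
  then have "(\<lambda>x\<in>flags M. inv_into (flags M) g x) \<in> automorphisms M"
    using g restrict_inv_into_Bij[OF B] unfolding automorphisms_iff
    by simp metis
  then show "inv\<^bsub>BijGroup (flags M)\<^esub> g \<in> automorphisms M"
    by (simp add: inv_BijGroup[OF B])
next
  fix g h assume "g \<in> automorphisms M" and h: "h \<in> automorphisms M"
  moreover have "h x \<in> flags M" if "x \<in> flags M" for x
    using h that Bij_imp_funcset funcset_mem unfolding automorphisms_iff by metis
  ultimately show "g \<otimes>\<^bsub>BijGroup (flags M)\<^esub> h \<in> automorphisms M"
    by (simp add: automorphisms_iff BijGroup_def compose_Bij compose_eq)
qed

lemma group_action_Aut: "group_action (Aut M) (flags M) (\<lambda>g. g)"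
proof -
  have "group (Aut M)" unfolding Aut_def
    by (rule subgroup.subgroup_is_group[OF subgroup_automorphisms group_BijGroup])
  moreover have "(\<lambda>g. g) \<in> hom (Aut M) (BijGroup (flags M))"
    using subgroup.subset[OF subgroup_automorphisms] by (auto simp: hom_def Aut_def)
  ultimately show ?thesis
    by (simp add: group_action_def group_hom_def group_hom_axioms_def group_BijGroup)
qed

sublocale aut: group_action "Aut M" "flags M" "\<lambda>g. g"
  by (rule group_action_Aut)

section \<open>The action of colours on flag orbits\<close>

lemma Aut_nbr:
  assumes "g \<in> carrier (Aut M)" "i \<in> {0, 1, 2, 3}" "x \<in> flags M"
  shows "nbr i (g x) = g (nbr i x)"
  using adjacent_nbr[OF assms(2,3)] nbr_in_flags[OF assms(2,3)] assms(1,3)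
  by (intro nbr_eqI) (simp add: Aut_def automorphisms_iff)

abbreviation orb :: "'f \<Rightarrow> 'f set" where
  "orb \<equiv> orbit (Aut M) (\<lambda>g. g)"

lemma flag_orbits_eq: "flag_orbits M = orb ` flags M"
  by (auto simp: flag_orbits_def orbits_def)

lemma orb_subset: "x \<in> flags M \<Longrightarrow> orb x \<subseteq> flags M"
  using aut.element_image by (auto simp: orbit_def)

lemma orb_eqI:
  assumes "x \<in> flags M" "y \<in> orb x"
  shows "orb y = orb x"
proof -
  have y: "y \<in> flags M" using assms orb_subset by blast
  have "x \<in> orb y" using aut.orbit_sym[OF assms(1) y assms(2)] .
  then show ?thesis
    using aut.orbit_trans[OF assms(1) y _ assms(2)] aut.orbit_trans[OF y assms(1)]
      orb_subset[OF assms(1)] orb_subset[OF y]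
    by blast
qed

text \<open>As automorphisms commute with \<open>nbr i\<close>, taking images under
  \<open>nbr i\<close> is a well-defined action of colour \<open>i\<close> on orbits.\<close>

lemma nbr_image_orb:
  assumes "i \<in> {0, 1, 2, 3}" "x \<in> flags M"
  shows "nbr i ` orb x = orb (nbr i x)"
  using Aut_nbr[OF _ assms] unfolding orbit_def Setcompr_eq_image image_image
  by (intro image_cong) simp_all

section \<open>From transitivity on faces to transitivity on orbits\<close>

lemma component_subset:
  assumes "x \<in> flags M"
  shows "component M C x \<subseteq> flags M"
proof
  fix y assume "y \<in> component M C x"
  then have "(x, y) \<in> {(u, v). \<exists>j\<in>C. adjacent M j u v}\<^sup>*" by (simp add: component_def)
  then show "y \<in> flags M"
    by (induction rule: rtrancl_induct) (use assms adjacentD(2) in auto)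
qed

text \<open>The colours in \<^term>\<open>- {i}\<close> other than \<open>0, 1, 2, 3\<close> colour no edge, so it does no harm that
  \<^const>\<open>faces\<close> admits them.\<close>

lemma component_orb:
  assumes y: "y \<in> component M (- {i}) x" and W: "orb x \<in> W"
    and closed: "\<And>j B. j \<in> {0, 1, 2, 3} - {i} \<Longrightarrow> B \<in> W \<Longrightarrow> nbr j ` B \<in> W"
  shows "orb y \<in> W"
proof -
  have "(x, y) \<in> {(u, v). \<exists>j\<in>- {i}. adjacent M j u v}\<^sup>*"
    using y by (simp add: component_def)
  then show ?thesis
  proof (induction rule: rtrancl_induct)
    case (step u v)
    then obtain j where j: "j \<noteq> i" "adjacent M j u v" by auto
    have "orb v = nbr j ` orb u"
      using nbr_image_orb[of j u] nbr_eqI[OF j(2)] adjacentD[OF j(2)] by simp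
    then show ?case using closed[of j "orb u"] step.IH j adjacentD(4)[OF j(2)] by simp
  qed (rule W)
qed

text \<open>Fix a flag \<open>x\<close> whose orbit lies in \<open>W\<close>. Walks avoiding colour
  \<open>i\<close> stay in orbits from \<open>W\<close>, so the whole \<open>i\<close>-face of
  \<open>x\<close> does. Any flag \<open>y\<close> is the image under an automorphism of some flag
  of that face, hence shares its orbit.\<close>

lemma fully_transitive_orbits:
  assumes "fully_transitive M" and i: "i \<in> {0, 1, 2, 3}"
    and W: "W \<subseteq> flag_orbits M" "W \<noteq> {}"
    and closed: "\<And>j B. j \<in> {0, 1, 2, 3} - {i} \<Longrightarrow> B \<in> W \<Longrightarrow> nbr j ` B \<in> W"
  shows "W = flag_orbits M"
proof
  obtain x where x: "x \<in> flags M" "orb x \<in> W" using W by (auto simp: flag_orbits_eq)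
  show "flag_orbits M \<subseteq> W"
  proof
    fix C assume "C \<in> flag_orbits M"
    then obtain y where y: "y \<in> flags M" "C = orb y" by (auto simp: flag_orbits_eq)
    let ?F = "component M (- {i})"
    have "?F x \<in> faces M i" "?F y \<in> faces M i"
      using x y by (auto simp: faces_def components_def)
    then obtain g where g: "g \<in> carrier (Aut M)" "g ` ?F x = ?F y"
      using assms(1) i unfolding fully_transitive_def by blast
    have "y \<in> ?F y" by (simp add: component_def)
    with g obtain x' where x': "x' \<in> ?F x" "y = g x'" by blast
    have "orb x' \<in> W" using component_orb[OF x'(1) x(2) closed] .
    moreover have "y \<in> orb x'" using g x' by (auto simp: orbit_def)
    moreover have "x' \<in> flags M"
      using component_subset[OF x(1)] x'(1) by blast
    ultimately show "C \<in> W" using orb_eqI[of x' y] y(2) by simp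
  qed
qed (rule W)

section \<open>Parity of the number of orbits\<close>

lemma reflexible_if_one_orbit:
  assumes "card (flag_orbits M) = 1"
  shows "reflexible M"
  unfolding reflexible_def
proof (intro ballI)
  fix x y assume xy: "x \<in> flags M" "y \<in> flags M"
  then have "orb x \<in> flag_orbits M" "orb y \<in> flag_orbits M" by (auto simp: flag_orbits_eq)
  then have "orb x = orb y" using assms by (auto simp: card_1_singleton_iff)
  then have "y \<in> orb x" using aut.orbit_refl xy by blast
  then show "\<exists>g\<in>carrier (Aut M). g x = y" by (auto simp: orbit_def)
qed

lemma odd_orbits_imp_reflexible:
  assumes "fully_transitive M" "finite (flag_orbits M)" "odd (card (flag_orbits M))"
  shows "reflexible M"
proof -
  have "card (flag_orbits M) = 1"
  proof (rule one_of_odd_transitive_involutions[where s = "\<lambda>i. (`) (nbr i)"])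
    fix i B assume i: "i \<in> {0, 1, 2, 3 :: nat}" and B: "B \<in> flag_orbits M"
    then have sub: "B \<subseteq> flags M" using orb_subset by (auto simp: flag_orbits_eq)
    show "nbr i ` B \<in> flag_orbits M"
      using i B by (auto simp: flag_orbits_eq nbr_image_orb intro!: imageI nbr_in_flags)
    \<comment> \<open>The laws of \<open>nbr\<close> hold on flags only; they carry over to images
      because an orbit consists of flags.\<close>
    have "(\<lambda>x. nbr i (nbr i x)) ` B = (\<lambda>x. x) ` B"
      using sub by (intro image_cong refl nbr_nbr[OF i]) auto
    then show "nbr i ` nbr i ` B = B" by (simp add: image_image)
    show "nbr i ` nbr j ` B = nbr j ` nbr i ` B"
      if "j \<in> {0, 1, 2, 3}" "\<bar>int i - int j\<bar> \<ge> 2" for j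
      unfolding image_image using sub i that by (intro image_cong refl nbr_commute) auto
  next
    show "W = flag_orbits M" if "i \<in> {0, 1, 2, 3}" "W \<subseteq> flag_orbits M" "W \<noteq> {}"
      "\<And>j B. j \<in> {0, 1, 2, 3} - {i} \<Longrightarrow> B \<in> W \<Longrightarrow> nbr j ` B \<in> W" for i W
      using assms(1) that by (rule fully_transitive_orbits)
  qed (use assms in auto)
  then show ?thesis by (rule reflexible_if_one_orbit)
qed

end

text \<open>The vertices of the symmetry type graph are the flag orbits, so the case to settle is
  that of a finite odd number of them. Evenness is claimed under finiteness, where
  \<open>card\<close> is the actual number of orbits.\<close>

theorem theorem4p8:
  fixes M :: "('f, 'm) coloured_graph_scheme"
  assumes "maniplex3 M"
    and "fully_transitive M"
  shows "reflexible M \<or>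
    (finite (vertices (symmetry_type_graph M)) \<longrightarrow> even (card (vertices (symmetry_type_graph M))))"
  using maniplex3.odd_orbits_imp_reflexible[OF assms] by (auto simp: symmetry_type_graph_def)

end
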